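(* Let $m\ge 1$, let $(X,d)$ be a compact metric space, let $f_0,\dots,f_{m-1}:X\to X$ be continuous, let $\varphi\in C(X,\mathbb{R})$ and $c\in\mathbb{R}$. Let $F:\Sigma_m\times X\to\Sigma_m\times X$ be the skew-product transformation $F(\omega,x)=(\sigma_m\omega,f_{\omega_0}(x))$ and let $g:\Sigma_m\times X\to\mathbb{R}$, $g(\omega,x)=c+\varphi(x)$. Then the topological pressure of $F$ with respect to $g$ satisfies \[P(F,g)=c+\log m+P(f_0,\dots,f_{m-1},\varphi).\]
   Context: Compact metric spaces are nonempty. $C(X,\mathbb{R})$ is the space of real-valued continuous functions on $X$. Words. $F_m^+$ is the set of finite words in the symbols $0,1,\dots,m-1$; $|w|$ is the length of $w$. Write $w'\le w$ if $w=w''w'$ for some nonempty word $w''$, where $w'$ may be empty; thus if $|w|=n$, the words $w'\le w$ are the $n$ suffixes of $w$ of lengths $0,1,\dots,n-1$. For $w=w_1w_2\cdots w_k$ put $f_w=f_{w_1}\circ f_{w_2}\circ\cdots\circ f_{w_k}$, with $f_w=\mathrm{id}$ for the empty word. Pressure of the free semigroup action. Let $d_w(x,y)=\max_{w'\le w}d(f_{w'}(x),f_{w'}(y))$ and $(S_w\varphi)(x)=\sum_{w'\le w}\varphi(f_{w'}(x))$. A set $E\subset X$ is $(w,\varepsilon,f_0,\dots,f_{m-1})$-spanning if for every $x\in X$ there is $y\in E$ with $d_w(x,y)<\varepsilon$. Put $Q_w(f_0,\dots,f_{m-1},\varphi,\varepsilon)=\inf\{\sum_{x\in E}e^{(S_w\varphi)(x)}: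 E \text{ is } (w,\varepsilon,f_0,\dots,f_{m-1})\text{-spanning}\}$, $Q_n(f_0,\dots,f_{m-1},\varphi,\varepsilon)=\frac1{m^n}\sum_{|w|=n}Q_w(f_0,\dots,f_{m-1},\varphi,\varepsilon)$ and $P(f_0,\dots,f_{m-1},\varphi)=\lim_{\varepsilon\to0}\limsup_{n\to\infty}\frac1n\log Q_n(f_0,\dots,f_{m-1},\varphi,\varepsilon)\in(-\infty,\infty]$. Skew product. $\Sigma_m=\{0,\dots,m-1\}^{\mathbb{Z}}$ with metric $d(\omega,\omega')=2^{-k}$, $k=\inf\{|n|:\omega_n\ne\omega'_n\}$ (and $d(\omega,\omega)=0$); $\sigma_m$ is the shift $(\sigma_m\omega)_i=\omega_{i+1}$; $\Sigma_m\times X$ has the metric $\max(d(\omega,\omega'),d(x,x'))$. $P(F,g)$ is the classical topological pressure of the single map $F$: the definition above for one map $F$ and potential $g$, i.e. $P(F,g)=\lim_{\varepsilon\to0}\limsup_{n\to\infty}\frac1n\log Q_n(F,g,\varepsilon)$, where $Q_n(F,g,\varepsilon)$ is the infimum of $\sum_{z\in E}\exp(\sum_{i=0}^{n-1}g(F^iz))$ over sets $E$ such that every point of $\Sigma_m\times X$ is at distance $<\varepsilon$ from some point of $E$ in the metric $\max_{0\le i\le n-1}d(F^i\cdot,F^i\cdot)$. *)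

theory Defs
  imports "HOL-Analysis.Analysis" "HOL-Library.Sublist"
begin

text \<open>
  A space is given by a carrier \<open>X\<close> together with a distance function, so that the same notions
  apply both to \<open>X\<close> with its own metric and to the product of the full shift with \<open>X\<close> under the
  maximum metric (the product metric of the library is the Euclidean one).
\<close>

definition ennlog :: "ennreal \<Rightarrow> ereal" where
  "ennlog q = (if q = 0 then - \<infinity> else if q = \<infinity> then \<infinity> else ereal (ln (enn2real q)))"

definition spanning :: "'a set \<Rightarrow> ('a \<Rightarrow> 'a \<Rightarrow> real) \<Rightarrow> real \<Rightarrow> 'a set \<Rightarrow> bool" where
  "spanning X \<rho> \<epsilon> E \<longleftrightarrow> E \<subseteq> X \<and> (\<forall>x\<in>X. \<exists>y\<in>E. \<rho> x y < \<epsilon>)"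

text \<open>
  Spanning sets need not be finite, hence the unordered sum in \<^typ>\<open>ennreal\<close>
  (\<^const>\<open>sum\<close> would be \<open>0\<close> on infinite sets).
\<close>

definition spanning_inf ::
    "'a set \<Rightarrow> ('a \<Rightarrow> 'a \<Rightarrow> real) \<Rightarrow> ('a \<Rightarrow> real) \<Rightarrow> real \<Rightarrow> ennreal" where
  "spanning_inf X \<rho> \<psi> \<epsilon> = (INF E\<in>{E. spanning X \<rho> \<epsilon> E}. \<Sum>\<^sub>\<infinity>x\<in>E. ennreal (exp (\<psi> x)))"

text \<open>
  The limit below always exists: a larger \<open>\<epsilon>\<close> has more spanning sets, so the upper
  exponential growth rate of \<open>Q\<close> is antitone in \<open>\<epsilon>\<close>. The term \<open>n = 0\<close> does not affect it.
\<close>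

definition growth_pressure :: "(nat \<Rightarrow> real \<Rightarrow> ennreal) \<Rightarrow> ereal" where
  "growth_pressure Q =
     Lim (at_right 0) (\<lambda>\<epsilon>. limsup (\<lambda>n. ereal (1 / real n) * ennlog (Q n \<epsilon>)))"


subsection \<open>Pressure of a free semigroup action\<close>

text \<open>
  \<open>word_map f [w\<^sub>1, \<dots>, w\<^sub>k] = f w\<^sub>1 \<circ> \<dots> \<circ> f w\<^sub>k\<close>. The relation \<open>w' \<le> w\<close> of the mathematical text,
  \<open>w = w'' w'\<close> with \<open>w''\<close> nonempty, is \<^const>\<open>strict_suffix\<close>.
\<close>

definition word_map :: "(nat \<Rightarrow> 'a \<Rightarrow> 'a) \<Rightarrow> nat list \<Rightarrow> 'a \<Rightarrow> 'a" where
  "word_map f w = foldr (\<circ>) (map f w) id"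

definition words :: "nat \<Rightarrow> nat \<Rightarrow> nat list set" where
  "words m n = {w. set w \<subseteq> {..<m} \<and> length w = n}"

definition word_dist ::
    "('a \<Rightarrow> 'a \<Rightarrow> real) \<Rightarrow> (nat \<Rightarrow> 'a \<Rightarrow> 'a) \<Rightarrow> nat list \<Rightarrow> 'a \<Rightarrow> 'a \<Rightarrow> real" where
  "word_dist d f w x y =
     Max ((\<lambda>w'. d (word_map f w' x) (word_map f w' y)) ` {w'. strict_suffix w' w})"

definition word_sum ::
    "(nat \<Rightarrow> 'a \<Rightarrow> 'a) \<Rightarrow> nat list \<Rightarrow> ('a \<Rightarrow> real) \<Rightarrow> 'a \<Rightarrow> real" where
  "word_sum f w \<phi> x = (\<Sum>w' | strict_suffix w' w. \<phi> (word_map f w' x))"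

definition Q_word ::
    "'a set \<Rightarrow> ('a \<Rightarrow> 'a \<Rightarrow> real) \<Rightarrow> (nat \<Rightarrow> 'a \<Rightarrow> 'a) \<Rightarrow> ('a \<Rightarrow> real) \<Rightarrow> nat list \<Rightarrow> real \<Rightarrow> ennreal" where
  "Q_word X d f \<phi> w \<epsilon> = spanning_inf X (word_dist d f w) (word_sum f w \<phi>) \<epsilon>"

definition Q_semigroup ::
    "'a set \<Rightarrow> ('a \<Rightarrow> 'a \<Rightarrow> real) \<Rightarrow> nat \<Rightarrow> (nat \<Rightarrow> 'a \<Rightarrow> 'a) \<Rightarrow> ('a \<Rightarrow> real) \<Rightarrow> nat \<Rightarrow> real \<Rightarrow> ennreal"
  where
  "Q_semigroup X d m f \<phi> n \<epsilon> = (\<Sum>w\<in>words m n. Q_word X d f \<phi> w \<epsilon>) / of_nat (m ^ n)"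

definition semigroup_pressure ::
    "'a set \<Rightarrow> ('a \<Rightarrow> 'a \<Rightarrow> real) \<Rightarrow> nat \<Rightarrow> (nat \<Rightarrow> 'a \<Rightarrow> 'a) \<Rightarrow> ('a \<Rightarrow> real) \<Rightarrow> ereal" where
  "semigroup_pressure X d m f \<phi> = growth_pressure (Q_semigroup X d m f \<phi>)"


subsection \<open>Topological pressure of a single map\<close>

definition bowen_dist ::
    "('a \<Rightarrow> 'a \<Rightarrow> real) \<Rightarrow> ('a \<Rightarrow> 'a) \<Rightarrow> nat \<Rightarrow> 'a \<Rightarrow> 'a \<Rightarrow> real" where
  "bowen_dist d T n x y = Max ((\<lambda>i. d ((T ^^ i) x) ((T ^^ i) y)) ` {..<n})"

definition Q_map ::
    "'a set \<Rightarrow> ('a \<Rightarrow> 'a \<Rightarrow> real) \<Rightarrow> ('a \<Rightarrow> 'a) \<Rightarrow> ('a \<Rightarrow> real) \<Rightarrow> nat \<Rightarrow> real \<Rightarrow> ennreal" where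
  "Q_map X d T g n \<epsilon> = spanning_inf X (bowen_dist d T n) (\<lambda>x. \<Sum>i<n. g ((T ^^ i) x)) \<epsilon>"

definition top_pressure ::
    "'a set \<Rightarrow> ('a \<Rightarrow> 'a \<Rightarrow> real) \<Rightarrow> ('a \<Rightarrow> 'a) \<Rightarrow> ('a \<Rightarrow> real) \<Rightarrow> ereal" where
  "top_pressure X d T g = growth_pressure (Q_map X d T g)"


subsection \<open>The skew product over the full shift\<close>

definition full_shift :: "nat \<Rightarrow> (int \<Rightarrow> nat) set" where
  "full_shift m = {\<omega>. \<forall>i. \<omega> i < m}"

definition shift_dist :: "(int \<Rightarrow> nat) \<Rightarrow> (int \<Rightarrow> nat) \<Rightarrow> real" where
  "shift_dist \<omega> \<omega>' =
     (if \<omega> = \<omega>' then 0 else (1 / 2) ^ Inf {nat \<bar>n\<bar> |n. \<omega> n \<noteq> \<omega>' n})"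

definition shift :: "(int \<Rightarrow> nat) \<Rightarrow> int \<Rightarrow> nat" where
  "shift \<omega> = (\<lambda>i. \<omega> (i + 1))"

definition skew_dist ::
    "('a \<Rightarrow> 'a \<Rightarrow> real) \<Rightarrow> (int \<Rightarrow> nat) \<times> 'a \<Rightarrow> (int \<Rightarrow> nat) \<times> 'a \<Rightarrow> real" where
  "skew_dist d = (\<lambda>(\<omega>, x) (\<omega>', x'). max (shift_dist \<omega> \<omega>') (d x x'))"

definition skew_product ::
    "(nat \<Rightarrow> 'a \<Rightarrow> 'a) \<Rightarrow> (int \<Rightarrow> nat) \<times> 'a \<Rightarrow> (int \<Rightarrow> nat) \<times> 'a" where
  "skew_product f = (\<lambda>(\<omega>, x). (shift \<omega>, f (\<omega> 0) x))"

end

theory Submission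
  imports Defs
begin

text \<open>
  Write \<open>F\<close> for the skew product. For \<open>\<omega>\<close> in the full shift let \<open>w\<close> be the word
  \<open>\<omega>\<^sub>n\<^sub>-\<^sub>1 \<dots> \<omega>\<^sub>1 \<omega>\<^sub>0\<close>. The point \<open>F\<^sup>i (\<omega>, x)\<close> has second coordinate \<open>f\<^sub>v x\<close>, where \<open>v\<close> is the
  suffix of \<open>w\<close> of length \<open>i\<close>. So in the \<open>X\<close>-coordinate the Bowen metric of \<open>F\<close> is \<open>d\<^sub>w\<close>, and the
  Birkhoff sum of \<open>c + \<phi>\<close> is \<open>n c + S\<^sub>w \<phi>\<close>. The shift coordinate only contributes the choice of
  \<open>w\<close> and boundedly many further symbols, as two estimates make precise:

  \<^item> If \<open>\<epsilon> \<le> 1\<close>, points that are \<open>\<epsilon>\<close>-close in the Bowen metric have the same word. A spanning set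
    for \<open>F\<close> therefore splits according to words, and the points with word \<open>w\<close> project to a
    \<open>(w, \<epsilon>)\<close>-spanning set of \<open>X\<close>. This is \<open>sum_Q_word_le_Q_map_skew\<close>.

  \<^item> If \<open>2\<^sup>-\<^sup>K < \<epsilon>\<close>, the orbit of \<open>\<omega>\<close> is followed up to \<open>\<epsilon>\<close> for times \<open>0, \<dots>, n - 1\<close> by every sequence
    that agrees with \<open>\<omega>\<close> on \<open>{-K..<n+K}\<close>. Hence \<open>(w, \<epsilon>)\<close>-spanning sets for all words, each copied
    once for every choice of the \<open>2 K\<close> symbols outside \<open>{0..<n}\<close>, give a spanning set for \<open>F\<close>.
    This is \<open>Q_map_skew_le_sum_Q_word\<close>.

  With \<open>Q\<close> and \<open>R\<close> the partition functions of \<open>F\<close> and of the semigroup, and since \<open>R\<close> averages over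
  the \<open>m\<^sup>n\<close> words, the outcome for small \<open>\<epsilon>\<close> is
  \<open>e\<^sup>n\<^sup>a R n \<epsilon> \<le> Q n \<epsilon> \<le> m\<^sup>2\<^sup>K e\<^sup>n\<^sup>a R n \<epsilon>\<close> with \<open>a = c + ln m\<close>. The factor \<open>m\<^sup>2\<^sup>K\<close> is independent of
  \<open>n\<close>, so it disappears from the exponential growth rate: the two rates differ by exactly \<open>a\<close>
  already at each fixed \<open>\<epsilon> \<le> 1\<close>, before \<open>\<epsilon>\<close> tends to \<open>0\<close> (\<open>growth_pressure_add\<close>).
\<close>

section \<open>Unordered sums of extended nonnegative reals\<close>

lemma summable_on_ennreal_function: "h summable_on A" for h :: "'b \<Rightarrow> ennreal"
  by (rule nonneg_summable_on_complete) simp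

lemma infsum_mono_set_ennreal:
  fixes h :: "'b \<Rightarrow> ennreal"
  assumes "A \<subseteq> B"
  shows "infsum h A \<le> infsum h B"
  using assms by (intro infsum_mono_neutral summable_on_ennreal_function) auto

lemma infsum_cmult_ennreal:
  fixes h :: "'b \<Rightarrow> ennreal"
  shows "(\<Sum>\<^sub>\<infinity>x\<in>A. c * h x) = c * infsum h A"
  by (simp add: nonneg_infsum_complete SUP_mult_left_ennreal sum_distrib_left)

lemma infsum_UN_disjoint_ennreal:
  fixes h :: "'b \<Rightarrow> ennreal"
  assumes "finite I" "disjoint_family_on A I"
  shows "infsum h (\<Union>i\<in>I. A i) = (\<Sum>i\<in>I. infsum h (A i))"
  using assms
proof (induction I rule: finite_induct)
  case (insert j I)
  have "infsum h (\<Union>i\<in>insert j I. A i) = infsum h (A j \<union> (\<Union>i\<in>I. A i))"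
    by simp
  also have "\<dots> = infsum h (A j) + infsum h (\<Union>i\<in>I. A i)"
    using insert by (intro infsum_Un_disjoint summable_on_ennreal_function)
      (auto simp: disjoint_family_on_def)
  also have "infsum h (\<Union>i\<in>I. A i) = (\<Sum>i\<in>I. infsum h (A i))"
    using insert.prems by (intro insert.IH disjoint_family_on_mono[of I "insert j I"]) auto
  finally show ?case
    using insert.hyps by simp
qed simp

text \<open>
  Several points of \<open>S\<close> may have the same image, and each image point is counted only once on
  the left; a section of \<open>p\<close> turns the left side into a sum over a subset of \<open>S\<close>.
\<close>

lemma infsum_image_le_ennreal:
  fixes h :: "'c \<Rightarrow> ennreal"
  shows "infsum h (p ` S) \<le> (\<Sum>\<^sub>\<infinity>z\<in>S. h (p z))"
proof -
  obtain T where T: "T \<subseteq> S" "inj_on p T" "p ` S = p ` T"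
    by (metis subset_image_inj order_refl)
  have "infsum h (p ` S) = infsum (h \<circ> p) T"
    unfolding T(3) using T(2) by (rule infsum_reindex)
  also have "\<dots> \<le> infsum (h \<circ> p) S"
    using T(1) by (rule infsum_mono_set_ennreal)
  finally show ?thesis
    by (simp add: o_def)
qed

text \<open>
  A finite sum of infima is approximated by choosing an almost optimal \<open>e\<close> for each index
  separately. Below, the \<open>E i\<close> are spanning sets, one for each word.
\<close>

lemma le_cmult_sum_INF_ennreal:
  fixes F :: "'i \<Rightarrow> 'b \<Rightarrow> ennreal"
  assumes fin: "finite I"
    and C: "0 < C" "C < top"
    and le: "\<And>E. (\<And>i. i \<in> I \<Longrightarrow> E i \<in> S i) \<Longrightarrow> q \<le> C * (\<Sum>i\<in>I. F i (E i))"
  shows "q \<le> C * (\<Sum>i\<in>I. INF e\<in>S i. F i e)"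
proof -
  have "q / C \<le> (\<Sum>i\<in>I. INF e\<in>S i. F i e)"
  proof (rule ennreal_le_epsilon)
    fix r :: real
    assume fin_sum: "(\<Sum>i\<in>I. INF e\<in>S i. F i e) < top" and r: "0 < r"
    \<comment> \<open>the error \<open>r\<close> is shared among the indices; \<open>+ 1\<close> covers an empty \<open>I\<close>\<close>
    define \<delta> where "\<delta> = r / real (card I + 1)"
    have \<delta>: "\<delta> > 0" "real (card I) * \<delta> \<le> r"
      using r by (auto simp: \<delta>_def field_simps)
    have "\<exists>e\<in>S i. F i e < (INF e\<in>S i. F i e) + ennreal \<delta>" if "i \<in> I" for i
    proof -
      have "(INF e\<in>S i. F i e) \<noteq> top"
        using fin_sum fin that unfolding ennreal_sum_less_top[OF fin] by (metis less_irrefl)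
      then have "(INF e\<in>S i. F i e) + 0 < (INF e\<in>S i. F i e) + ennreal \<delta>"
        using \<delta>(1) by (subst ennreal_add_left_cancel_less) simp
      then show ?thesis
        by (simp only: add_0_right INF_less_iff)
    qed
    then obtain E where E: "\<And>i. i \<in> I \<Longrightarrow> E i \<in> S i"
      and E_less: "\<And>i. i \<in> I \<Longrightarrow> F i (E i) < (INF e\<in>S i. F i e) + ennreal \<delta>"
      by metis
    have "q / C \<le> (\<Sum>i\<in>I. F i (E i))"
      using le[OF E] C(1) by (intro divide_le_posI_ennreal) (simp_all add: mult.commute)
    also have "\<dots> \<le> (\<Sum>i\<in>I. (INF e\<in>S i. F i e) + ennreal \<delta>)"
      using E_less by (intro sum_mono less_imp_le)
    also have "\<dots> = (\<Sum>i\<in>I. INF e\<in>S i. F i e) + ennreal (real (card I) * \<delta>)"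
      using \<delta>(1) by (simp add: sum.distrib ennreal_mult ennreal_of_nat_eq_real_of_nat)
    also have "\<dots> \<le> (\<Sum>i\<in>I. INF e\<in>S i. F i e) + ennreal r"
      using \<delta>(2) by (intro add_left_mono ennreal_leI)
    finally show "q / C \<le> (\<Sum>i\<in>I. INF e\<in>S i. F i e) + ennreal r" .
  qed
  then have "C * (q / C) \<le> C * (\<Sum>i\<in>I. INF e\<in>S i. F i e)"
    by (rule mult_left_mono) simp
  moreover have "C * (q / C) = q"
    using C by (simp add: ennreal_times_divide ennreal_mult_divide_eq mult.commute[of C])
  ultimately show ?thesis
    by simp
qed


section \<open>Logarithms and growth rates\<close>

lemma ennlog_mono: "p \<le> q \<Longrightarrow> ennlog p \<le> ennlog q"
  by (cases p; cases q)
     (auto simp: ennlog_def top_unique ennreal_less_top)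

text \<open>
  This holds for all \<open>q\<close>, including \<open>0\<close> and \<open>\<infinity>\<close>, because adding a real number fixes \<open>\<plusminus>\<infinity>\<close>.
\<close>

lemma ennlog_exp_mult: "ennlog (ennreal (exp a) * q) = ereal a + ennlog q"
proof (cases q)
  case (real r)
  show ?thesis
    using real by (cases "r = 0") (auto simp: ennlog_def ennreal_mult_eq_top_iff ln_mult simp flip: ennreal_mult)
qed (auto simp: ennlog_def ennreal_mult_top)

text \<open>A larger radius admits more spanning sets.\<close>

lemma spanning_inf_antimono:
  assumes "\<epsilon> \<le> \<delta>"
  shows "spanning_inf X \<rho> \<psi> \<delta> \<le> spanning_inf X \<rho> \<psi> \<epsilon>"
  unfolding spanning_inf_def spanning_def
  using assms by (intro INF_superset_mono) (auto, meson less_le_trans)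

lemma Q_semigroup_antimono:
  "\<epsilon> \<le> \<delta> \<Longrightarrow> Q_semigroup X d m f \<phi> n \<delta> \<le> Q_semigroup X d m f \<phi> n \<epsilon>"
  unfolding Q_semigroup_def Q_word_def
  by (intro divide_right_mono_ennreal sum_mono spanning_inf_antimono)

lemma tendsto_at_right_antimono:
  fixes h :: "real \<Rightarrow> ereal"
  assumes anti: "\<And>s t. 0 < s \<Longrightarrow> s \<le> t \<Longrightarrow> h t \<le> h s"
  shows "(h \<longlongrightarrow> (SUP t\<in>{0<..}. h t)) (at_right 0)"
proof (rule order_tendstoI)
  fix a assume "a < (SUP t\<in>{0<..}. h t)"
  then obtain t where t: "0 < t" "a < h t"
    by (auto simp: less_SUP_iff)
  show "\<forall>\<^sub>F s in at_right 0. a < h s"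
    unfolding eventually_at_right_field
    using t anti by (intro exI[of _ t]) (auto intro: less_le_trans)
next
  fix a assume "(SUP t\<in>{0<..}. h t) < a"
  then show "\<forall>\<^sub>F s in at_right 0. h s < a"
    unfolding eventually_at_right_field
    by (intro exI[of _ 1]) (auto intro: le_less_trans[OF SUP_upper])
qed

text \<open>
  A bounded factor \<open>e\<^sup>b\<close> changes the logarithm divided by \<open>n\<close> by \<open>b / n\<close>, which vanishes in
  the limit; so the upper growth rates of \<open>Q\<close> and \<open>R\<close> differ by \<open>a\<close> for each small \<open>\<epsilon>\<close>. As
  \<^const>\<open>Lim\<close> is meaningful only when the limit exists, the constant can be moved out of it
  only once convergence of the rate of \<open>R\<close> is known, which is where \<open>anti\<close> enters.
\<close>

lemma growth_pressure_add:
  assumes anti: "\<And>n \<epsilon> \<delta>. 0 < \<epsilon> \<Longrightarrow> \<epsilon> \<le> \<delta> \<Longrightarrow> R n \<delta> \<le> R n \<epsilon>"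
    and lower: "\<And>n \<epsilon>. n \<ge> 1 \<Longrightarrow> 0 < \<epsilon> \<Longrightarrow> \<epsilon> \<le> 1 \<Longrightarrow>
      ennreal (exp (real n * a)) * R n \<epsilon> \<le> Q n \<epsilon>"
    and upper: "\<And>\<epsilon>. 0 < \<epsilon> \<Longrightarrow> \<epsilon> \<le> 1 \<Longrightarrow>
      \<exists>b. \<forall>n\<ge>1. Q n \<epsilon> \<le> ennreal (exp (real n * a + b)) * R n \<epsilon>"
  shows "growth_pressure Q = ereal a + growth_pressure R"
proof -
  define rate where "rate P \<epsilon> = limsup (\<lambda>n. ereal (1 / real n) * ennlog (P n \<epsilon>))"
    for P :: "nat \<Rightarrow> real \<Rightarrow> ennreal" and \<epsilon>
  have step: "ereal (1 / real n) * ennlog (ennreal (exp (real n * a + b)) * R n \<epsilon>)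
      = ereal (a + b / real n) + ereal (1 / real n) * ennlog (R n \<epsilon>)" if "n \<ge> 1" for n b \<epsilon>
  proof -
    have "ereal (1 / real n) * ennlog (ennreal (exp (real n * a + b)) * R n \<epsilon>)
        = ereal (1 / real n) * ereal (real n * a + b) + ereal (1 / real n) * ennlog (R n \<epsilon>)"
      unfolding ennlog_exp_mult by (rule ereal_distrib_left) auto
    also have "ereal (1 / real n) * ereal (real n * a + b) = ereal (a + b / real n)"
      using that by (simp add: field_simps)
    finally show ?thesis .
  qed
  have rate_eq: "rate Q \<epsilon> = ereal a + rate R \<epsilon>" if \<epsilon>: "0 < \<epsilon>" "\<epsilon> \<le> 1" for \<epsilon>
  proof (rule antisym)
    obtain b where b: "\<And>n. n \<ge> 1 \<Longrightarrow> Q n \<epsilon> \<le> ennreal (exp (real n * a + b)) * R n \<epsilon>"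
      using upper[OF \<epsilon>] by blast
    have "rate Q \<epsilon> \<le> limsup (\<lambda>n. ereal (a + b / real n) + ereal (1 / real n) * ennlog (R n \<epsilon>))"
      unfolding rate_def
    proof (rule Limsup_mono, rule eventually_mono[OF eventually_ge_at_top[of 1]])
      fix n :: nat assume n: "1 \<le> n"
      show "ereal (1 / real n) * ennlog (Q n \<epsilon>)
          \<le> ereal (a + b / real n) + ereal (1 / real n) * ennlog (R n \<epsilon>)"
        unfolding step[OF n, symmetric] by (intro ereal_mult_left_mono ennlog_mono b n) simp
    qed
    also have "\<dots> = ereal a + rate R \<epsilon>"
      unfolding rate_def
    proof (rule ereal_limsup_lim_add)
      have "(\<lambda>n. a + b / real n) \<longlonglongrightarrow> a + 0"
        by (intro tendsto_add tendsto_const lim_const_over_n)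
      then show "(\<lambda>n. ereal (a + b / real n)) \<longlonglongrightarrow> ereal a"
        by simp
    qed simp
    finally show "rate Q \<epsilon> \<le> ereal a + rate R \<epsilon>" .
  next
    have "ereal a + rate R \<epsilon> = limsup (\<lambda>n. ereal a + ereal (1 / real n) * ennlog (R n \<epsilon>))"
      unfolding rate_def by (rule ereal_limsup_lim_add[symmetric]) auto
    also have "\<dots> \<le> rate Q \<epsilon>"
      unfolding rate_def
    proof (rule Limsup_mono, rule eventually_mono[OF eventually_ge_at_top[of 1]])
      fix n :: nat assume n: "1 \<le> n"
      have "ereal a + ereal (1 / real n) * ennlog (R n \<epsilon>)
          = ereal (1 / real n) * ennlog (ennreal (exp (real n * a)) * R n \<epsilon>)"
        using step[OF n, of 0] by simp
      also have "\<dots> \<le> ereal (1 / real n) * ennlog (Q n \<epsilon>)"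
        by (intro ereal_mult_left_mono ennlog_mono lower n \<epsilon>) simp
      finally show "ereal a + ereal (1 / real n) * ennlog (R n \<epsilon>)
          \<le> ereal (1 / real n) * ennlog (Q n \<epsilon>)" .
    qed
    finally show "ereal a + rate R \<epsilon> \<le> rate Q \<epsilon>" .
  qed
  define L where "L = (SUP \<epsilon>\<in>{0<..}. rate R \<epsilon>)"
  have R_lim: "(rate R \<longlongrightarrow> L) (at_right 0)"
    unfolding L_def
  proof (rule tendsto_at_right_antimono)
    fix s t :: real assume "0 < s" "s \<le> t"
    then show "rate R t \<le> rate R s"
      unfolding rate_def
      by (intro Limsup_mono always_eventually allI ereal_mult_left_mono ennlog_mono anti) auto
  qed
  then have "((\<lambda>\<epsilon>. rate R \<epsilon> + ereal a) \<longlongrightarrow> L + ereal a) (at_right 0)"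
    by (rule tendsto_add_left_ereal[rotated]) simp
  moreover have "\<forall>\<^sub>F \<epsilon> in at_right 0. rate R \<epsilon> + ereal a = rate Q \<epsilon>"
    unfolding eventually_at_right_field
    by (intro exI[of _ 1]) (auto simp: rate_eq add.commute)
  ultimately have "(rate Q \<longlongrightarrow> L + ereal a) (at_right 0)"
    by (rule Lim_transform_eventually)
  with R_lim show ?thesis
    unfolding growth_pressure_def rate_def[symmetric]
    by (simp add: tendsto_Lim add.commute)
qed


section \<open>Itineraries\<close>

text \<open>
  The symbols are listed backwards in time because \<^const>\<open>word_map\<close> applies the last letter
  first. In this order the suffix of length \<open>i\<close> of an itinerary is the itinerary up to time \<open>i\<close>.
\<close>

definition itinerary :: "nat \<Rightarrow> (int \<Rightarrow> nat) \<Rightarrow> nat list" where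
  "itinerary n \<omega> = rev (map (\<lambda>i. \<omega> (int i)) [0..<n])"

lemma itinerary_simps [simp]:
  "itinerary 0 \<omega> = []" "itinerary (Suc n) \<omega> = \<omega> (int n) # itinerary n \<omega>"
  by (auto simp: itinerary_def)

lemma length_itinerary [simp]: "length (itinerary n \<omega>) = n"
  by (simp add: itinerary_def)

lemma itinerary_eq_iff:
  "itinerary n \<omega> = itinerary n \<omega>' \<longleftrightarrow> (\<forall>i<n. \<omega> (int i) = \<omega>' (int i))"
  by (auto simp: itinerary_def)

lemma itinerary_in_words: "\<omega> \<in> full_shift m \<Longrightarrow> itinerary n \<omega> \<in> words m n"
  by (auto simp: itinerary_def words_def full_shift_def)

lemma words_itineraryE:
  assumes "m \<ge> 1" "w \<in> words m n"
  obtains \<omega> where "\<omega> \<in> full_shift m" "itinerary n \<omega> = w"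
proof
  define \<omega> where "\<omega> = (\<lambda>i. if 0 \<le> i \<and> i < int n then rev w ! nat i else 0)"
  have len: "length w = n" and w: "set w \<subseteq> {..<m}"
    using assms(2) by (auto simp: words_def)
  show "\<omega> \<in> full_shift m"
    unfolding full_shift_def
  proof (safe)
    fix i
    have "rev w ! nat i \<in> set w" if "0 \<le> i" "i < int n"
    proof -
      have "rev w ! nat i \<in> set (rev w)" using that len by (intro nth_mem) auto
      then show ?thesis by simp
    qed
    then show "\<omega> i < m"
      using w assms(1) by (auto simp: \<omega>_def)
  qed
  have "map (\<lambda>i. \<omega> (int i)) [0..<n] = rev w"
    by (rule nth_equalityI) (auto simp: len \<omega>_def)
  then show "itinerary n \<omega> = w"
    by (simp add: itinerary_def)
qed

lemma finite_words: "finite (words m n)"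
  unfolding words_def by (rule finite_lists_length_eq) simp

lemma strict_suffixes_itinerary:
  "{w'. strict_suffix w' (itinerary n \<omega>)} = (\<lambda>i. itinerary i \<omega>) ` {..<n}"
proof (induction n)
  case (Suc n)
  have "strict_suffix w' (a # w) \<longleftrightarrow> w' = w \<or> strict_suffix w' w" for w' w :: "nat list" and a
    by (auto simp: strict_suffix_def suffix_Cons)
      (auto simp: suffix_def)
  then show ?case
    using Suc by (auto simp: lessThan_Suc)
qed (auto simp: strict_suffix_def)

lemma skew_product_iterate:
  "(skew_product f ^^ n) (\<omega>, x)
    = ((\<lambda>i. \<omega> (i + int n)), word_map f (itinerary n \<omega>) x)"
  by (induction n) (auto simp: word_map_def skew_product_def shift_def algebra_simps)

lemma word_dist_itinerary_less_iff:
  assumes "n \<ge> 1"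
  shows "word_dist d f (itinerary n \<omega>) x y < \<epsilon> \<longleftrightarrow>
    (\<forall>i<n. d (word_map f (itinerary i \<omega>) x) (word_map f (itinerary i \<omega>) y) < \<epsilon>)"
  unfolding word_dist_def strict_suffixes_itinerary
  using assms by (subst Max_less_iff) (auto simp: lessThan_empty_iff)

lemma bowen_dist_skew_less_iff:
  assumes "n \<ge> 1"
  shows "bowen_dist (skew_dist d) (skew_product f) n (\<omega>, x) (\<omega>', x') < \<epsilon> \<longleftrightarrow>
    (\<forall>i<n. shift_dist (\<lambda>j. \<omega> (j + int i)) (\<lambda>j. \<omega>' (j + int i)) < \<epsilon> \<and>
      d (word_map f (itinerary i \<omega>) x) (word_map f (itinerary i \<omega>') x') < \<epsilon>)"
  unfolding bowen_dist_def skew_product_iterate skew_dist_def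
  using assms by (subst Max_less_iff) (auto simp: lessThan_empty_iff)

lemma birkhoff_sum_skew:
  "(\<Sum>i<n. (\<lambda>(\<omega>, x). c + \<phi> x) ((skew_product f ^^ i) (\<omega>, x)))
    = real n * c + word_sum f (itinerary n \<omega>) \<phi> x"
proof -
  have "inj_on (\<lambda>i. itinerary i \<omega>) {..<n}"
    by (rule inj_onI) (metis length_itinerary)
  then have "word_sum f (itinerary n \<omega>) \<phi> x = (\<Sum>i<n. \<phi> (word_map f (itinerary i \<omega>) x))"
    unfolding word_sum_def strict_suffixes_itinerary by (simp add: sum.reindex)
  then show ?thesis
    by (simp add: skew_product_iterate sum.distrib)
qed

text \<open>
  The next two lemmas are all that is used about the metric of the shift: a distance below \<open>1\<close>
  determines the symbol at \<open>0\<close>, and agreement on a window around \<open>0\<close> bounds the distance.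
\<close>

lemma shift_dist_less_one_imp_eq: "shift_dist \<omega> \<omega>' < 1 \<Longrightarrow> \<omega> 0 = \<omega>' 0"
proof (rule ccontr)
  assume less: "shift_dist \<omega> \<omega>' < 1" and "\<omega> 0 \<noteq> \<omega>' 0"
  then have "nat \<bar>0\<bar> \<in> {nat \<bar>n\<bar> |n. \<omega> n \<noteq> \<omega>' n}"
    by blast
  then have "Inf {nat \<bar>n\<bar> |n. \<omega> n \<noteq> \<omega>' n} \<le> nat \<bar>0\<bar>"
    by (rule cInf_lower) simp
  with less show False
    using \<open>\<omega> 0 \<noteq> \<omega>' 0\<close> by (auto simp: shift_dist_def split: if_splits)
qed

lemma shift_dist_le_power:
  assumes "\<And>j. \<bar>j\<bar> < int K \<Longrightarrow> \<omega> j = \<omega>' j"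
  shows "shift_dist \<omega> \<omega>' \<le> (1 / 2) ^ K"
proof (cases "\<omega> = \<omega>'")
  case False
  then have "{nat \<bar>n\<bar> |n. \<omega> n \<noteq> \<omega>' n} \<noteq> {}"
    by auto
  then have "K \<le> Inf {nat \<bar>n\<bar> |n. \<omega> n \<noteq> \<omega>' n}"
    by (rule cInf_greatest) (use assms in force)
  then show ?thesis
    using False by (simp add: shift_dist_def power_decreasing)
qed (simp add: shift_dist_def)


section \<open>Comparison of the two partition functions\<close>

text \<open>
  Fix a word \<open>w\<close>, a sequence \<open>\<omega>\<close> with itinerary \<open>w\<close> and \<open>x \<in> X\<close>. The point of \<open>E\<close> close to \<open>(\<omega>, x)\<close>
  must have itinerary \<open>w\<close> as well, since \<open>\<epsilon> \<le> 1\<close>. Thus the part \<open>P w\<close> of \<open>E\<close> over \<open>w\<close> already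
  projects to a spanning set for \<open>w\<close>, and these parts are disjoint for different words.
\<close>

lemma sum_Q_word_le_Q_map_skew:
  assumes "m \<ge> 1" "n \<ge> 1" "\<epsilon> \<le> 1"
  shows "ennreal (exp (real n * c)) * (\<Sum>w\<in>words m n. Q_word X d f \<phi> w \<epsilon>)
    \<le> Q_map (full_shift m \<times> X) (skew_dist d) (skew_product f) (\<lambda>(\<omega>, x). c + \<phi> x) n \<epsilon>"
  unfolding Q_map_def spanning_inf_def
proof (rule INF_greatest, clarify)
  fix E
  assume E: "spanning (full_shift m \<times> X) (bowen_dist (skew_dist d) (skew_product f) n) \<epsilon> E"
  define h where
    "h z = ennreal (exp (\<Sum>i<n. (\<lambda>(\<omega>, x). c + \<phi> x) ((skew_product f ^^ i) z)))" for z
  define P where "P w = {z \<in> E. itinerary n (fst z) = w}" for w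
  have le: "ennreal (exp (real n * c)) * Q_word X d f \<phi> w \<epsilon> \<le> infsum h (P w)"
    if w: "w \<in> words m n" for w
  proof -
    obtain \<omega> where \<omega>: "\<omega> \<in> full_shift m" "itinerary n \<omega> = w"
      using words_itineraryE[OF assms(1) w] .
    have "spanning X (word_dist d f w) \<epsilon> (snd ` P w)"
      unfolding spanning_def
    proof (intro conjI ballI)
      show "snd ` P w \<subseteq> X"
        using E by (auto simp: P_def spanning_def)
      fix x assume "x \<in> X"
      then obtain \<omega>' y where y: "(\<omega>', y) \<in> E"
        "bowen_dist (skew_dist d) (skew_product f) n (\<omega>, x) (\<omega>', y) < \<epsilon>"
        using E \<omega>(1) unfolding spanning_def by (metis SigmaI surj_pair)
      then have close: "shift_dist (\<lambda>j. \<omega> (j + int i)) (\<lambda>j. \<omega>' (j + int i)) < \<epsilon>"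
        "d (word_map f (itinerary i \<omega>) x) (word_map f (itinerary i \<omega>') y) < \<epsilon>" if "i < n" for i
        using that assms(2) by (auto simp: bowen_dist_skew_less_iff)
      have same: "\<omega> (int i) = \<omega>' (int i)" if "i < n" for i
        using shift_dist_less_one_imp_eq[OF less_le_trans[OF close(1)[OF that] assms(3)]] by simp
      then have itin: "itinerary i \<omega> = itinerary i \<omega>'" if "i \<le> n" for i
        using that by (simp add: itinerary_eq_iff)
      have "word_dist d f w x y < \<epsilon>"
        unfolding \<omega>(2)[symmetric] word_dist_itinerary_less_iff[OF assms(2)]
        using close(2) itin by (metis less_imp_le)
      moreover have "(\<omega>', y) \<in> P w"
        using y(1) itin[of n] \<omega>(2) by (simp add: P_def)
      ultimately show "\<exists>y\<in>snd ` P w. word_dist d f w x y < \<epsilon>"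
        by force
    qed
    then have "Q_word X d f \<phi> w \<epsilon> \<le> (\<Sum>\<^sub>\<infinity>x\<in>snd ` P w. ennreal (exp (word_sum f w \<phi> x)))"
      unfolding Q_word_def spanning_inf_def by (intro INF_lower) simp
    also have "\<dots> \<le> (\<Sum>\<^sub>\<infinity>z\<in>P w. ennreal (exp (word_sum f w \<phi> (snd z))))"
      by (rule infsum_image_le_ennreal)
    finally have "ennreal (exp (real n * c)) * Q_word X d f \<phi> w \<epsilon>
        \<le> ennreal (exp (real n * c)) * (\<Sum>\<^sub>\<infinity>z\<in>P w. ennreal (exp (word_sum f w \<phi> (snd z))))"
      by (intro mult_left_mono) auto
    also have "\<dots> = infsum h (P w)"
      unfolding infsum_cmult_ennreal[symmetric]
      by (intro infsum_cong)
        (auto simp: h_def P_def birkhoff_sum_skew exp_add simp flip: ennreal_mult)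
    finally show ?thesis .
  qed
  have "ennreal (exp (real n * c)) * (\<Sum>w\<in>words m n. Q_word X d f \<phi> w \<epsilon>)
      \<le> (\<Sum>w\<in>words m n. infsum h (P w))"
    unfolding sum_distrib_left using le by (rule sum_mono)
  also have "\<dots> = infsum h (\<Union>w\<in>words m n. P w)"
    by (rule infsum_UN_disjoint_ennreal[symmetric])
      (auto simp: finite_words P_def disjoint_family_on_def)
  also have "\<dots> \<le> infsum h E"
    by (rule infsum_mono_set_ennreal) (auto simp: P_def)
  finally show "ennreal (exp (real n * c)) * (\<Sum>w\<in>words m n. Q_word X d f \<phi> w \<epsilon>)
      \<le> (\<Sum>\<^sub>\<infinity>z\<in>E. ennreal (exp (\<Sum>i<n. (\<lambda>(\<omega>, x). c + \<phi> x) ((skew_product f ^^ i) z))))"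
    unfolding h_def .
qed

text \<open>
  One representative for each pattern of symbols on the window \<open>{-K..<n+K}\<close>, obtained by padding
  with the symbol \<open>0\<close>. These sequences are the base points of the spanning set of the skew product.
\<close>

definition window_points :: "nat \<Rightarrow> nat \<Rightarrow> nat \<Rightarrow> (int \<Rightarrow> nat) set" where
  "window_points m n K = {\<omega> \<in> full_shift m. \<forall>i. i \<notin> {- int K..<int n + int K} \<longrightarrow> \<omega> i = 0}"

lemma finite_window_points: "finite (window_points m n K)"
proof (rule finite_subset)
  show "window_points m n K \<subseteq> {\<omega>. \<forall>i. (i \<in> {- int K..<int n + int K} \<longrightarrow> \<omega> i \<in> {..<m}) \<and>
      (i \<notin> {- int K..<int n + int K} \<longrightarrow> \<omega> i = 0)}"
    by (auto simp: window_points_def full_shift_def)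
  show "finite {\<omega>. \<forall>i. (i \<in> {- int K..<int n + int K} \<longrightarrow> \<omega> i \<in> {..<m}) \<and>
      (i \<notin> {- int K..<int n + int K} \<longrightarrow> \<omega> i = 0)}"
    by (rule finite_set_of_finite_funs) simp_all
qed

text \<open>
  The itinerary fixes the symbols on \<open>{0..<n}\<close>; only \<open>K\<close> symbols on each side remain free. The
  bound does not depend on \<open>n\<close>.
\<close>

lemma card_window_points_itinerary_le:
  "card {\<omega> \<in> window_points m n K. itinerary n \<omega> = w} \<le> m ^ (2 * K)"
proof -
  define J where "J = {- int K..<0} \<union> {int n..<int n + int K}"
  have J: "finite J" "card J = 2 * K"
    unfolding J_def by (auto simp: card_Un_disjoint)
  have "card {\<omega> \<in> window_points m n K. itinerary n \<omega> = w} \<le> card (PiE J (\<lambda>_. {..<m}))"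
  proof (rule card_inj_on_le[where f = "\<lambda>\<omega>. restrict \<omega> J"])
    show "inj_on (\<lambda>\<omega>. restrict \<omega> J) {\<omega> \<in> window_points m n K. itinerary n \<omega> = w}"
    proof (rule inj_onI, rule ext)
      fix \<omega> \<omega>' and i :: int
      assume \<omega>: "\<omega> \<in> {\<omega> \<in> window_points m n K. itinerary n \<omega> = w}"
        and \<omega>': "\<omega>' \<in> {\<omega> \<in> window_points m n K. itinerary n \<omega> = w}"
        and eq: "restrict \<omega> J = restrict \<omega>' J"
      consider "i \<in> J" | "0 \<le> i" "i < int n" | "i \<notin> {- int K..<int n + int K}"
        unfolding J_def by force
      then show "\<omega> i = \<omega>' i"
      proof cases
        case 1
        then show ?thesis using eq by (metis restrict_apply')
      next
        case 2
        have "\<forall>j<n. \<omega> (int j) = \<omega>' (int j)"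
          using \<omega> \<omega>' by (simp add: itinerary_eq_iff[symmetric])
        moreover have "nat i < n"
          using 2 by linarith
        ultimately have "\<omega> (int (nat i)) = \<omega>' (int (nat i))"
          by blast
        then show ?thesis using 2 by simp
      next
        case 3
        then show ?thesis using \<omega> \<omega>' by (simp add: window_points_def)
      qed
    qed
    show "(\<lambda>\<omega>. restrict \<omega> J) ` {\<omega> \<in> window_points m n K. itinerary n \<omega> = w}
        \<subseteq> PiE J (\<lambda>_. {..<m})"
      by (intro image_subsetI restrict_PiE_iff[THEN iffD2])
        (auto simp: window_points_def full_shift_def)
    show "finite (PiE J (\<lambda>_. {..<m}))"
      using J(1) by (rule finite_PiE) simp
  qed
  then show ?thesis
    by (simp add: card_PiE J)
qed

text \<open>
  Over each representative \<open>\<omega>\<close> put a spanning set for the itinerary of \<open>\<omega>\<close>. Any \<open>\<omega>\<close> in the full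
  shift and its truncation \<open>\<omega>'\<close> to the window agree around each of the positions \<open>0, \<dots>, n - 1\<close>
  at all distances below \<open>K\<close>, so the orbits stay within \<open>2\<^sup>-\<^sup>K < \<epsilon>\<close> of each other.
\<close>

lemma Q_map_skew_le_sum_Q_word:
  assumes "m \<ge> 1" "n \<ge> 1" "(1 / 2) ^ K < \<epsilon>"
  shows "Q_map (full_shift m \<times> X) (skew_dist d) (skew_product f) (\<lambda>(\<omega>, x). c + \<phi> x) n \<epsilon>
    \<le> ennreal (exp (real n * c)) * of_nat (m ^ (2 * K)) * (\<Sum>w\<in>words m n. Q_word X d f \<phi> w \<epsilon>)"
    (is "?Q \<le> ?C * _")
proof -
  have le: "?Q \<le> ?C * (\<Sum>w\<in>words m n. \<Sum>\<^sub>\<infinity>x\<in>E w. ennreal (exp (word_sum f w \<phi> x)))"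
    if E: "\<And>w. w \<in> words m n \<Longrightarrow> E w \<in> {E. spanning X (word_dist d f w) \<epsilon> E}" for E
  proof -
    define h where
      "h z = ennreal (exp (\<Sum>i<n. (\<lambda>(\<omega>, x). c + \<phi> x) ((skew_product f ^^ i) z)))" for z
    define s where "s w = (\<Sum>\<^sub>\<infinity>x\<in>E w. ennreal (exp (word_sum f w \<phi> x)))" for w
    define W where "W = window_points m n K"
    define D where "D = (\<Union>\<omega>\<in>W. Pair \<omega> ` E (itinerary n \<omega>))"
    have W_shift: "\<omega> \<in> full_shift m" if "\<omega> \<in> W" for \<omega>
      using that by (simp add: W_def window_points_def)
    have W_words: "itinerary n \<omega> \<in> words m n" if "\<omega> \<in> W" for \<omega>
      by (rule itinerary_in_words[OF W_shift[OF that]])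
    have "spanning (full_shift m \<times> X) (bowen_dist (skew_dist d) (skew_product f) n) \<epsilon> D"
      unfolding spanning_def
    proof (intro conjI ballI)
      show "D \<subseteq> full_shift m \<times> X"
        using E[OF W_words] W_shift by (auto simp: D_def spanning_def)
    next
      fix z assume "z \<in> full_shift m \<times> X"
      then obtain \<omega> x where z: "z = (\<omega>, x)" "\<omega> \<in> full_shift m" "x \<in> X"
        by auto
      define \<omega>' where "\<omega>' i = (if i \<in> {- int K..<int n + int K} then \<omega> i else 0)" for i
      have \<omega>': "\<omega>' \<in> W"
        using z(2) assms(1) by (auto simp: W_def window_points_def full_shift_def \<omega>'_def)
      have itin: "itinerary i \<omega>' = itinerary i \<omega>" if "i \<le> n" for i
        using that by (simp add: itinerary_eq_iff \<omega>'_def)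
      obtain y where y: "y \<in> E (itinerary n \<omega>)" "word_dist d f (itinerary n \<omega>) x y < \<epsilon>"
        using E[OF itinerary_in_words[OF z(2)]] z(3) by (auto simp: spanning_def)
      have "shift_dist (\<lambda>j. \<omega> (j + int i)) (\<lambda>j. \<omega>' (j + int i)) < \<epsilon>" if "i < n" for i
      proof (rule le_less_trans[OF shift_dist_le_power assms(3)])
        fix j :: int assume "\<bar>j\<bar> < int K"
        then show "\<omega> (j + int i) = \<omega>' (j + int i)"
          using that by (auto simp: \<omega>'_def)
      qed
      then have "bowen_dist (skew_dist d) (skew_product f) n z (\<omega>', y) < \<epsilon>"
        using y(2) itin unfolding z(1)
        by (simp add: bowen_dist_skew_less_iff[OF assms(2)] word_dist_itinerary_less_iff[OF assms(2)])
      moreover have "(\<omega>', y) \<in> D"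
        unfolding D_def using \<omega>' y(1) itin[of n] by (intro UN_I[of \<omega>']) auto
      ultimately show "\<exists>z'\<in>D. bowen_dist (skew_dist d) (skew_product f) n z z' < \<epsilon>"
        by blast
    qed
    then have "?Q \<le> infsum h D"
      unfolding Q_map_def spanning_inf_def h_def by (intro INF_lower) simp
    also have "\<dots> = (\<Sum>\<omega>\<in>W. infsum h (Pair \<omega> ` E (itinerary n \<omega>)))"
      unfolding D_def
      by (rule infsum_UN_disjoint_ennreal)
        (auto simp: W_def finite_window_points disjoint_family_on_def)
    also have "\<dots> = (\<Sum>\<omega>\<in>W. ennreal (exp (real n * c)) * s (itinerary n \<omega>))"
    proof (rule sum.cong)
      fix \<omega> assume "\<omega> \<in> W"
      have "infsum h (Pair \<omega> ` E (itinerary n \<omega>)) = infsum (h \<circ> Pair \<omega>) (E (itinerary n \<omega>))"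
        by (rule infsum_reindex) (auto intro: inj_onI)
      also have "\<dots> = (\<Sum>\<^sub>\<infinity>x\<in>E (itinerary n \<omega>). ennreal (exp (real n * c)) *
          ennreal (exp (word_sum f (itinerary n \<omega>) \<phi> x)))"
        by (simp add: h_def o_def birkhoff_sum_skew exp_add ennreal_mult)
      finally show "infsum h (Pair \<omega> ` E (itinerary n \<omega>))
          = ennreal (exp (real n * c)) * s (itinerary n \<omega>)"
        by (simp add: infsum_cmult_ennreal s_def)
    qed simp
    \<comment> \<open>The summand depends on \<open>\<omega>\<close> only through its itinerary, so group by itineraries.\<close>
    also have "\<dots> = (\<Sum>w\<in>words m n. \<Sum>\<omega>\<in>{\<omega> \<in> W. itinerary n \<omega> = w}.
        ennreal (exp (real n * c)) * s (itinerary n \<omega>))"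
      using W_words by (intro sum.group[symmetric]) (auto simp: W_def finite_window_points finite_words)
    also have "\<dots> = (\<Sum>w\<in>words m n. of_nat (card {\<omega> \<in> W. itinerary n \<omega> = w}) *
        (ennreal (exp (real n * c)) * s w))"
      by (intro sum.cong) auto
    also have "\<dots> \<le> (\<Sum>w\<in>words m n. of_nat (m ^ (2 * K)) * (ennreal (exp (real n * c)) * s w))"
      unfolding W_def
      by (intro sum_mono mult_right_mono of_nat_mono card_window_points_itinerary_le) simp
    also have "\<dots> = ?C * (\<Sum>w\<in>words m n. s w)"
      by (subst sum_distrib_left) (simp only: mult_ac)
    finally show ?thesis
      unfolding s_def .
  qed
  have "0 < ?C" "?C < top"
    using assms(1) by (auto simp: ennreal_zero_less_mult_iff ennreal_mult_less_top of_nat_less_top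
        simp del: of_nat_power)
  then show ?thesis
    unfolding Q_word_def spanning_inf_def[of X]
    by (rule le_cmult_sum_INF_ennreal[OF finite_words]) (rule le)
qed

theorem theorem1p1:
  fixes X :: "'a :: metric_space set"
    and m :: nat
    and f :: "nat \<Rightarrow> 'a \<Rightarrow> 'a"
    and \<phi> :: "'a \<Rightarrow> real"
    and c :: real
  assumes "m \<ge> 1"
    and "compact X" and "X \<noteq> {}"
    and "\<And>i. i < m \<Longrightarrow> continuous_on X (f i)"
    and "\<And>i. i < m \<Longrightarrow> f i \<in> X \<rightarrow> X"
    and "continuous_on X \<phi>"
  shows "top_pressure (full_shift m \<times> X) (skew_dist dist) (skew_product f) (\<lambda>(\<omega>, x). c + \<phi> x)
       = ereal c + ereal (ln (real m)) + semigroup_pressure X dist m f \<phi>"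
proof -
  let ?R = "Q_semigroup X dist m f \<phi>"
  let ?Q = "Q_map (full_shift m \<times> X) (skew_dist dist) (skew_product f) (\<lambda>(\<omega>, x). c + \<phi> x)"
  have pow: "ennreal (exp (real k * ln (real m))) = of_nat (m ^ k)" for k
    using assms(1) by (simp add: exp_of_nat_mult ennreal_power ennreal_of_nat_eq_real_of_nat)
  \<comment> \<open>undoes the average over words; this is the source of the summand \<open>ln m\<close>\<close>
  have sum_eq: "(\<Sum>w\<in>words m n. Q_word X dist f \<phi> w \<epsilon>) = of_nat (m ^ n) * ?R n \<epsilon>" for n \<epsilon>
  proof -
    have "of_nat (m ^ n) \<noteq> (0 :: ennreal)"
      using assms(1) by simp
    then show ?thesis
      unfolding Q_semigroup_def
      by (metis ennreal_mult_divide_eq ennreal_times_divide mult.commute ennreal_of_nat_neq_top)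
  qed
  have "growth_pressure ?Q = ereal (c + ln (real m)) + growth_pressure ?R"
  proof (rule growth_pressure_add)
    show "?R n \<delta> \<le> ?R n \<epsilon>" if "\<epsilon> \<le> \<delta>" for n \<epsilon> \<delta>
      using that by (rule Q_semigroup_antimono)
    show "ennreal (exp (real n * (c + ln (real m)))) * ?R n \<epsilon> \<le> ?Q n \<epsilon>"
      if "n \<ge> 1" "\<epsilon> \<le> 1" for n \<epsilon>
      using sum_Q_word_le_Q_map_skew[OF assms(1) that, of c X dist f \<phi>]
      unfolding sum_eq pow[symmetric]
      by (simp add: distrib_left exp_add ennreal_mult mult.assoc)
    fix \<epsilon> :: real assume "0 < \<epsilon>"
    then obtain K where K: "(1 / 2) ^ K < \<epsilon>"
      using real_arch_pow_inv[of \<epsilon> "1 / 2"] by auto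
    have "?Q n \<epsilon> \<le> ennreal (exp (real n * (c + ln (real m)) + real (2 * K) * ln (real m))) * ?R n \<epsilon>"
      if "n \<ge> 1" for n
      using Q_map_skew_le_sum_Q_word[OF assms(1) that K, of X dist f c \<phi>]
      unfolding sum_eq pow[symmetric]
      by (simp add: distrib_left exp_add ennreal_mult mult_ac)
    then show "\<exists>b. \<forall>n\<ge>1. ?Q n \<epsilon> \<le> ennreal (exp (real n * (c + ln (real m)) + b)) * ?R n \<epsilon>"
      by blast
  qed
  then show ?thesis
    by (simp add: top_pressure_def semigroup_pressure_def)
qed

end
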